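(* Fix $t>0$. With probability one, the scaled Conga line $u_t$ is real analytic on $(0,1)$. The power series expansion of $u_t$ around $x_0\in(0,1)$ converges in $$\left(\frac{\sqrt2\,x_0}{1+\sqrt2},\ \min\{\sqrt2\,x_0,1\}\right).$$
   Context: Fix $\alpha\in(0,1)$, $\sigma=\sqrt{\alpha(1-\alpha)}$ and $\sigma_t=\sigma/\sqrt t$. Let $W$ be a standard one-dimensional Brownian motion on $[0,1]$. The scaled (one-dimensional) Conga line at time $t$ is the random function of $x\in(0,1]$ $$u_t(x)=\int_0^1W(1-z)\frac{1}{\sqrt{2\pi}}\,\frac{x+\alpha z}{2\sigma_t z^{3/2}}\exp\left(-\frac{(x-\alpha z)^2}{2\sigma_t^2z}\right)dz .$$ *)

theory Defs
  imports "HOL-Probability.Probability"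
begin

locale standard_brownian_motion = prob_space M for M :: "'a measure" +
  fixes W :: "real \<Rightarrow> 'a \<Rightarrow> real"
  assumes random_variable_W: "\<And>s. s \<in> {0..1} \<Longrightarrow> random_variable borel (W s)"
    and start_zero: "AE \<omega> in M. W 0 \<omega> = 0"
    and normal_increments:
      "\<And>r s. 0 \<le> r \<Longrightarrow> r < s \<Longrightarrow> s \<le> 1 \<Longrightarrow>
         distributed M lborel (\<lambda>\<omega>. W s \<omega> - W r \<omega>) (normal_density 0 (sqrt (s - r)))"
    and independent_increments:
      "\<And>(n::nat) \<tau>. mono_on {..n} \<tau> \<Longrightarrow> \<tau> ` {..n} \<subseteq> {0..1} \<Longrightarrow>
         indep_vars (\<lambda>_. borel) (\<lambda>i \<omega>. W (\<tau> (Suc i)) \<omega> - W (\<tau> i) \<omega>) {..<n}"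
    and continuous_paths: "AE \<omega> in M. continuous_on {0..1} (\<lambda>s. W s \<omega>)"

definition conga_sigma :: "real \<Rightarrow> real \<Rightarrow> real" where
  "conga_sigma \<alpha> t = sqrt (\<alpha> * (1 - \<alpha>)) / sqrt t"

text \<open>The path \<open>w\<close> is a realisation \<open>\<lambda>s. W s \<omega>\<close> of the Brownian motion; only arguments
  \<open>x > 0\<close> are meaningful, and \<open>conga_sigma\<close> is the scaled \<open>\<sigma>\<^sub>t = \<sigma> / sqrt t\<close>.\<close>

definition conga_line :: "real \<Rightarrow> real \<Rightarrow> (real \<Rightarrow> real) \<Rightarrow> real \<Rightarrow> real" where
  "conga_line \<alpha> t w x =
     (LINT z:{0..1}|lborel.
        w (1 - z) * (1 / sqrt (2 * pi)) *
        ((x + \<alpha> * z) / (2 * conga_sigma \<alpha> t * z powr (3 / 2))) *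
        exp (- ((x - \<alpha> * z)\<^sup>2 / (2 * (conga_sigma \<alpha> t)\<^sup>2 * z))))"

text \<open>Intended for open \<open>S\<close>: the expansion is required on a full neighbourhood of each point.\<close>

definition real_analytic_on :: "(real \<Rightarrow> real) \<Rightarrow> real set \<Rightarrow> bool" where
  "real_analytic_on f S \<longleftrightarrow>
     (\<forall>x\<^sub>0\<in>S. \<exists>a. \<exists>r>0. \<forall>x\<in>ball x\<^sub>0 r. (\<lambda>n. a n * (x - x\<^sub>0) ^ n) sums f x)"

end

theory Submission imports Defs "HOL-Complex_Analysis.Complex_Analysis" "HOL-Real_Asymp.Real_Asymp"
begin

text \<open>
  Almost every Brownian path \<open>w\<close> is continuous on \<open>[0, 1]\<close>, and the claim holds for each continuous
  path separately. Write \<open>s\<close> for \<open>\<sigma>\<^sub>t\<close>. Expanding the square in the exponent,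
    \<open>(x - \<alpha> z)\<^sup>2 / (2 s\<^sup>2 z) = (x\<^sup>2 / (2 s\<^sup>2)) / z - \<alpha> x / s\<^sup>2 + \<alpha>\<^sup>2 z / (2 s\<^sup>2)\<close>,
  turns the Conga line into a constant multiple of the entire factor \<open>exp (\<alpha> x / s\<^sup>2)\<close> times a
  combination, with coefficients \<open>x\<close> and \<open>\<alpha>\<close>, of integrals
    \<open>\<integral> g(z) z\<^sup>p exp (- q / z) dz\<close> over \<open>[0, 1]\<close>, where \<open>q = x\<^sup>2 / (2 s\<^sup>2)\<close>,
  \<open>p\<close> is \<open>-3/2\<close> or \<open>-1/2\<close> respectively, and \<open>g\<close> is continuous. On the half-plane \<open>Re q > 0\<close> the exponential
  beats every power of \<open>z\<close> at \<open>0\<close>, so that one may differentiate under the integral sign, and the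
  integral is holomorphic in \<open>q\<close> (\<open>holomorphic_on_integral_laplace_kernel\<close>).

  Hence \<open>u\<^sub>t\<close> is the restriction to the positive half-line of a function that is holomorphic wherever
  \<open>Re (x\<^sup>2) > 0\<close> and \<open>Re x > 0\<close>, that is, on the sector \<open>\<bar>Im x\<bar> < Re x\<close>
  (\<open>conga_line_eq_Re_holomorphic\<close>). A holomorphic function equals its Taylor series on every disc
  inside its domain, and the real derivatives at a real point are the complex ones
  (\<open>taylor_sums_Re_holomorphic\<close>). The largest disc about \<open>x\<^sub>0\<close> in the sector has radius
  \<open>x\<^sub>0 / sqrt 2\<close>. The endpoints \<open>sqrt 2 x\<^sub>0 / (1 + sqrt 2) = (2 - sqrt 2) x\<^sub>0\<close> and \<open>sqrt 2 x\<^sub>0\<close> both have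
  distance \<open>(sqrt 2 - 1) x\<^sub>0\<close> from \<open>x\<^sub>0\<close>, which is less than \<open>x\<^sub>0 / 2\<close>, so the disc of radius \<open>x\<^sub>0 / 2\<close>
  already covers the interval.
\<close>

section \<open>Integrals against the kernel z to the p times exp(-q/z)\<close>

text \<open>
  At the endpoint \<open>z = 0\<close> the expression has the value \<open>0\<close>, because \<open>0 powr p = 0\<close> for every \<open>p\<close>;
  this agrees with its limit from the right, since \<open>exp (- (c / z))\<close> vanishes at \<open>0\<close> to infinite
  order. So the conventions for division and \<open>powr\<close> at \<open>0\<close> already give the continuous
  extension of the singular integrand, for negative \<open>p\<close> as well.
\<close>

lemma continuous_on_powr_times_exp_inverse:
  fixes p c :: real
  assumes "0 < c"
  shows "continuous_on {0..} (\<lambda>z. z powr p * exp (- (c / z)))"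
proof -
  have "((\<lambda>z. z powr p * exp (- (c / z))) \<longlongrightarrow> 0) (at_right 0)"
    using assms by real_asymp
  then have zero: "((\<lambda>z. z powr p * exp (- (c / z))) \<longlongrightarrow> 0) (at 0 within {0..})"
    by (simp add: at_within_Ici_at_right)
  show ?thesis
    unfolding continuous_on_def
  proof
    fix z :: real
    assume "z \<in> {0..}"
    show "((\<lambda>z. z powr p * exp (- (c / z))) \<longlongrightarrow> z powr p * exp (- (c / z))) (at z within {0..})"
    proof (cases "z = 0")
      case True
      then show ?thesis using zero by simp
    next
      case False
      then show ?thesis by (auto intro!: tendsto_intros)
    qed
  qed
qed

text \<open>
  In the variable \<open>u = 1 / z\<close> this is the Laplace kernel \<open>exp (- q u)\<close> with a power weight, which is
  why the half-plane \<open>Re q > 0\<close> is its natural domain.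
\<close>

definition laplace_kernel :: "real \<Rightarrow> complex \<Rightarrow> real \<Rightarrow> complex" where
  "laplace_kernel p q z = of_real (z powr p) * exp (- (q / of_real z))"

lemma norm_laplace_kernel: "norm (laplace_kernel p q z) = z powr p * exp (- (Re q / z))"
  by (simp add: laplace_kernel_def norm_mult)

text \<open>
  Joint continuity at a point \<open>(q, 0)\<close> is the substantial case. There the kernel is dominated, for
  all first arguments close to \<open>q\<close>, by the real function \<open>z powr p * exp (- (c / z))\<close> with a fixed
  \<open>c > 0\<close> below \<open>Re q\<close>, which tends to \<open>0\<close> with \<open>z\<close>.
\<close>

lemma continuous_on_laplace_kernel:
  "continuous_on ({q. 0 < Re q} \<times> {0..}) (\<lambda>x. laplace_kernel p (fst x) (snd x))"
  unfolding continuous_on_def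
proof
  fix x :: "complex \<times> real"
  let ?S = "{q. 0 < Re q} \<times> {0::real..}"
  assume x: "x \<in> ?S"
  show "((\<lambda>x. laplace_kernel p (fst x) (snd x)) \<longlongrightarrow> laplace_kernel p (fst x) (snd x))
             (at x within ?S)"
  proof (cases "snd x = 0")
    case False
    then show ?thesis
      unfolding laplace_kernel_def by (auto intro!: tendsto_intros)
  next
    case True
    define c where "c = Re (fst x) / 2"
    have "0 < c" "c < Re (fst x)"
      using x by (auto simp: c_def)
    have "continuous_on ?S (\<lambda>x. snd x powr p * exp (- (c / snd x)))"
      using continuous_on_powr_times_exp_inverse[OF \<open>0 < c\<close>]
      by (rule continuous_on_compose2) (auto intro!: continuous_intros)
    then have bound: "((\<lambda>x. snd x powr p * exp (- (c / snd x))) \<longlongrightarrow> 0) (at x within ?S)"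
      using x True unfolding continuous_on_def by (force dest: bspec[of _ _ x])
    have "((\<lambda>x. Re (fst x)) \<longlongrightarrow> Re (fst x)) (at x within ?S)"
      by (intro tendsto_intros)
    then have "\<forall>\<^sub>F y in at x within ?S. c < Re (fst y)"
      using \<open>c < Re (fst x)\<close> by (rule order_tendstoD)
    moreover have "\<forall>\<^sub>F y in at x within ?S. y \<in> ?S"
      by (simp add: eventually_at_filter)
    ultimately have "\<forall>\<^sub>F y in at x within ?S.
        norm (laplace_kernel p (fst y) (snd y)) \<le> snd y powr p * exp (- (c / snd y))"
      by eventually_elim
        (auto simp: norm_laplace_kernel intro!: mult_left_mono divide_right_mono)
    from Lim_null_comparison[OF this bound] show ?thesis
      using True by (simp add: laplace_kernel_def)
  qed
qed

lemma continuous_on_laplace_kernel_right: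
  assumes "0 < Re q"
  shows "continuous_on {0..b} (laplace_kernel p q)"
  using assms
  by (auto intro: continuous_on_compose2[OF continuous_on_laplace_kernel, of _ "Pair q", simplified]
      intro!: continuous_intros)

text \<open>
  Differentiating in \<open>q\<close> only lowers the exponent \<open>p\<close>, so the continuity result for arbitrary \<open>p\<close>
  also controls the derivative.
\<close>

lemma has_field_derivative_laplace_kernel:
  assumes "0 \<le> z"
  shows "((\<lambda>q. laplace_kernel p q z) has_field_derivative - laplace_kernel (p - 1) q z) (at q within A)"
proof (cases "z = 0")
  case True
  then show ?thesis by (simp add: laplace_kernel_def)
next
  case False
  with assms have "z powr p = z powr (p - 1) * z"
    by (simp add: powr_diff)
  then show ?thesis
    using False unfolding laplace_kernel_def
    by (auto intro!: derivative_eq_intros)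
qed

lemma holomorphic_on_integral_laplace_kernel:
  assumes "continuous_on {0..b} g"
  shows "(\<lambda>q. integral {0..b} (\<lambda>z. g z * laplace_kernel p q z)) holomorphic_on {q. 0 < Re q}"
proof -
  let ?U = "{q. 0 < Re q}"
  have "(\<lambda>q. integral (cbox 0 b) (\<lambda>z. g z * laplace_kernel p q z)) holomorphic_on ?U"
  proof (rule leibniz_rule_holomorphic)
    show "((\<lambda>q. g z * laplace_kernel p q z) has_field_derivative g z * - laplace_kernel (p - 1) q z)
        (at q within ?U)" if "z \<in> cbox 0 b" for q z
      using that by (intro DERIV_cmult has_field_derivative_laplace_kernel) auto
    show "(\<lambda>z. g z * laplace_kernel p q z) integrable_on cbox 0 b" if "q \<in> ?U" for q
      using that assms
      by (intro integrable_continuous continuous_intros)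
        (auto intro: continuous_on_laplace_kernel_right)
    have "continuous_on (?U \<times> {0..b}) (\<lambda>x. g (snd x))"
      using assms by (rule continuous_on_compose2) (auto intro!: continuous_intros)
    moreover have "continuous_on (?U \<times> {0..b}) (\<lambda>x. laplace_kernel (p - 1) (fst x) (snd x))"
      using continuous_on_laplace_kernel[of "p - 1"]
      by (rule continuous_on_subset) auto
    ultimately show "continuous_on (?U \<times> cbox 0 b) (\<lambda>(q, z). g z * - laplace_kernel (p - 1) q z)"
      by (auto simp: case_prod_beta' intro!: continuous_intros)
    show "convex ?U"
      by (rule convex_halfspace_Re_gt)
  qed
  then show ?thesis by simp
qed

section \<open>Taylor series of real functions with a holomorphic extension\<close>

lemma higher_deriv_Re_holomorphic:
  fixes f :: "real \<Rightarrow> real"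
  assumes hol: "F holomorphic_on S" and "open S" "open U"
    and sub: "of_real ` U \<subseteq> S"
    and eq: "\<And>x. x \<in> U \<Longrightarrow> f x = Re (F (of_real x))"
    and "x \<in> U"
  shows "(deriv ^^ n) f x = Re ((deriv ^^ n) F (of_real x))"
  using \<open>x \<in> U\<close>
proof (induction n arbitrary: x)
  case 0
  then show ?case by (simp add: eq)
next
  case (Suc n)
  have "(deriv ^^ n) F field_differentiable at (of_real x)"
    using holomorphic_higher_deriv[OF hol \<open>open S\<close>, of n] Suc.prems sub \<open>open S\<close>
    by (auto intro: holomorphic_on_imp_differentiable_at)
  then have "((deriv ^^ n) F has_field_derivative (deriv ^^ Suc n) F (of_real x)) (at (of_real x))"
    by (simp add: DERIV_deriv_iff_field_differentiable)
  then have "((\<lambda>y. Re ((deriv ^^ n) F (of_real y))) has_field_derivative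
      Re ((deriv ^^ Suc n) F (of_real x))) (at x)"
    unfolding has_real_derivative_iff_has_vector_derivative
    by (intro bounded_linear.has_vector_derivative[OF bounded_linear_Re]
        has_vector_derivative_real_field)
  then have "((deriv ^^ n) f has_field_derivative Re ((deriv ^^ Suc n) F (of_real x))) (at x)"
    by (rule has_field_derivative_transform_within_open[OF _ \<open>open U\<close> Suc.prems])
      (simp add: Suc.IH)
  then show ?case
    by (simp add: DERIV_imp_deriv)
qed

text \<open>
  The complex Taylor series converges on the whole disc; at a real point its real part is the
  Taylor series of \<open>f\<close>. Stating the hypothesis through \<open>Re\<close> avoids having to know
  that \<open>F\<close> takes real values on the real axis.
\<close>

lemma taylor_sums_Re_holomorphic:
  fixes f :: "real \<Rightarrow> real"
  assumes hol: "F holomorphic_on ball (of_real x0) r"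
    and eq: "\<And>x. x \<in> ball x0 r \<Longrightarrow> f x = Re (F (of_real x))"
    and x: "x \<in> ball x0 r"
  shows "(\<lambda>n. (deriv ^^ n) f x0 / fact n * (x - x0) ^ n) sums f x"
proof -
  have sub: "complex_of_real ` ball x0 r \<subseteq> ball (of_real x0) r"
    by (auto simp: dist_of_real)
  have "x0 \<in> ball x0 r"
    using x le_less_trans[OF zero_le_dist[of x0 x]] by simp
  then have coeff: "(deriv ^^ n) f x0 = Re ((deriv ^^ n) F (of_real x0))" for n
    by (intro higher_deriv_Re_holomorphic[OF hol open_ball open_ball sub eq])
  have "(\<lambda>n. (deriv ^^ n) F (of_real x0) / fact n * (of_real x - of_real x0) ^ n) sums F (of_real x)"
    using x sub by (intro holomorphic_power_series[OF hol]) auto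
  then have "(\<lambda>n. Re ((deriv ^^ n) F (of_real x0) / fact n * (of_real x - of_real x0) ^ n))
      sums Re (F (of_real x))"
    by (rule sums_Re)
  moreover have "Re ((deriv ^^ n) F (of_real x0) / fact n * (of_real x - of_real x0) ^ n) =
      (deriv ^^ n) f x0 / fact n * (x - x0) ^ n" for n
  proof -
    have "Re (z / fact n * (of_real x - of_real x0) ^ n) = Re z / fact n * (x - x0) ^ n" for z :: complex
    proof -
      have "z / fact n * (of_real x - of_real x0) ^ n = z * complex_of_real ((x - x0) ^ n / fact n)"
        by simp
      then show ?thesis
        by (simp only: Re_complex_of_real Im_complex_of_real times_complex.sel) simp
    qed
    then show ?thesis by (simp add: coeff)
  qed
  ultimately show ?thesis
    using eq[OF x] by simp
qed

section \<open>The holomorphic extension of the Conga line\<close>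

text \<open>
  With \<open>q = x\<^sup>2 / (2 s\<^sup>2)\<close>, the half-plane \<open>Re q > 0\<close> pulls back to \<open>\<bar>Im x\<bar> < \<bar>Re x\<bar>\<close>, whose
  component in the right half-plane is the sector below. The extension splits the factor
  \<open>(x + \<alpha> z) z\<^bsup>-3/2\<^esup>\<close> as \<open>x z\<^bsup>-3/2\<^esup> + \<alpha> z\<^bsup>-1/2\<^esup>\<close>, and absorbs into \<open>g\<close> the part of the Gaussian that
  does not involve \<open>x\<close>.
\<close>

lemma conga_line_eq_Re_holomorphic:
  fixes \<alpha> t :: real and w :: "real \<Rightarrow> real"
  assumes cont: "continuous_on {0..1} w" and "0 < \<alpha>" "\<alpha> < 1" "0 < t"
  obtains F where "F holomorphic_on {z. \<bar>Im z\<bar> < Re z}"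
    and "\<And>x. 0 < x \<Longrightarrow> conga_line \<alpha> t w x = Re (F (of_real x))"
proof -
  define s where "s = conga_sigma \<alpha> t"
  have "0 < s"
    using assms by (simp add: s_def conga_sigma_def)
  define g where "g z = complex_of_real (w (1 - z) * exp (- (\<alpha>\<^sup>2 * z / (2 * s\<^sup>2))))" for z
  have g: "continuous_on {0..1} g"
    unfolding g_def
    by (intro continuous_intros continuous_on_compose2[OF cont]) (use \<open>0 < s\<close> in auto)
  define J where "J p q = integral {0..1} (\<lambda>z. g z * laplace_kernel p q z)" for p q
  define E where "E x = exp (\<alpha> * x / s\<^sup>2) / (2 * s * sqrt (2 * pi))" for x :: complex
  define Q where "Q x = x\<^sup>2 / (2 * s\<^sup>2)" for x :: complex
  define F where "F x = E x * (x * J (-3/2) (Q x) + \<alpha> * J (-1/2) (Q x))" for x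
  have Q: "0 < Re (Q x)" if "\<bar>Im x\<bar> < Re x" for x
  proof -
    have "(Im x)\<^sup>2 < (Re x)\<^sup>2"
      using that by (intro power2_strict_mono) auto
    moreover have "Q x = x\<^sup>2 / of_real (2 * s\<^sup>2)"
      by (simp add: Q_def)
    ultimately show ?thesis
      using \<open>0 < s\<close> by (simp only: Re_divide_of_real) (simp add: Re_power2)
  qed
  have J: "(\<lambda>x. J p (Q x)) holomorphic_on {z. \<bar>Im z\<bar> < Re z}" for p
  proof -
    have "J p \<circ> Q holomorphic_on {z. \<bar>Im z\<bar> < Re z}"
    proof (rule holomorphic_on_compose_gen)
      show "Q holomorphic_on {z. \<bar>Im z\<bar> < Re z}"
        unfolding Q_def using \<open>0 < s\<close> by (auto intro!: holomorphic_intros)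
      show "J p holomorphic_on {q. 0 < Re q}"
        unfolding J_def by (rule holomorphic_on_integral_laplace_kernel[OF g])
    qed (use Q in auto)
    then show ?thesis by (simp add: o_def)
  qed
  show thesis
  proof
    show "F holomorphic_on {z. \<bar>Im z\<bar> < Re z}"
      unfolding F_def E_def using \<open>0 < s\<close> by (auto intro!: holomorphic_intros J)
  next
    fix x :: real
    assume "0 < x"
    define G where "G z = E x * (x * (g z * laplace_kernel (-3/2) (Q x) z)
        + \<alpha> * (g z * laplace_kernel (-1/2) (Q x) z))" for z
    have k: "continuous_on {0..1} (\<lambda>z. g z * laplace_kernel p (Q x) z)" for p
      using Q[of x] \<open>0 < x\<close>
      by (intro continuous_intros g continuous_on_laplace_kernel_right) auto
    have G: "continuous_on {0..1} G"
      unfolding G_def by (intro continuous_intros k)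
    have int_G: "integral {0..1} G = F x"
      unfolding G_def F_def J_def
      using k integrable_continuous_real[OF k]
      by (simp add: integral_add integral_mult_right integrable_on_mult_right)
    \<comment> \<open>At \<open>z = 0\<close> both sides are \<open>0\<close> by the conventions for division and \<open>powr\<close>.\<close>
    have integrand: "w (1 - z) * (1 / sqrt (2 * pi)) *
        ((x + \<alpha> * z) / (2 * s * z powr (3 / 2))) *
        exp (- ((x - \<alpha> * z)\<^sup>2 / (2 * s\<^sup>2 * z))) = Re (G z)" if "z \<in> {0..1}" for z
    proof (cases "z = 0")
      case True
      then show ?thesis by (simp add: G_def laplace_kernel_def)
    next
      case False
      with that have "0 < z" by simp
      have expo: "exp (- ((x - \<alpha> * z)\<^sup>2 / (2 * s\<^sup>2 * z))) =
          exp (\<alpha> * x / s\<^sup>2) * exp (- (\<alpha>\<^sup>2 * z / (2 * s\<^sup>2))) * exp (- (x\<^sup>2 / (2 * s\<^sup>2) / z))"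
        unfolding exp_add[symmetric] using \<open>0 < z\<close> \<open>0 < s\<close>
        by (intro arg_cong[where f = exp]) (simp add: field_simps power2_eq_square)
      have pow: "z powr (-3/2) = 1 / z powr (3/2)" "z powr (-1/2) = z / z powr (3/2)"
        using \<open>0 < z\<close> powr_minus_divide[of z "3/2"] powr_diff[of z 1 "3/2"] by simp_all
      have "G z = of_real (exp (\<alpha> * x / s\<^sup>2) / (2 * s * sqrt (2 * pi)) *
          (x * (w (1 - z) * exp (- (\<alpha>\<^sup>2 * z / (2 * s\<^sup>2))) *
              (z powr (-3/2) * exp (- (x\<^sup>2 / (2 * s\<^sup>2) / z))))
         + \<alpha> * (w (1 - z) * exp (- (\<alpha>\<^sup>2 * z / (2 * s\<^sup>2))) *
              (z powr (-1/2) * exp (- (x\<^sup>2 / (2 * s\<^sup>2) / z))))))"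
        by (simp add: G_def E_def Q_def g_def laplace_kernel_def flip: exp_of_real)
      then show ?thesis
        unfolding expo pow
        using \<open>0 < z\<close> \<open>0 < s\<close> by (simp only: Re_complex_of_real) (simp add: field_simps)
    qed
    have "conga_line \<alpha> t w x = (LINT z:{0..1}|lborel. Re (G z))"
      unfolding conga_line_def s_def[symmetric]
      by (intro set_lebesgue_integral_cong allI impI integrand) auto
    also have "\<dots> = integral {0..1} (\<lambda>z. Re (G z))"
      by (intro set_borel_integral_eq_integral borel_integrable_atLeastAtMost' continuous_intros G)
    also have "\<dots> = Re (integral {0..1} G)"
      using integral_linear[OF integrable_continuous_real[OF G] bounded_linear_Re]
      by (simp add: o_def)
    finally show "conga_line \<alpha> t w x = Re (F (of_real x))"
      by (simp add: int_G)
  qed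
qed

lemma ball_subset_sector:
  assumes "0 < x0"
  shows "ball (complex_of_real x0) (x0 / 2) \<subseteq> {z. \<bar>Im z\<bar> < Re z}"
proof
  fix z
  assume "z \<in> ball (complex_of_real x0) (x0 / 2)"
  then have "norm (z - x0) < x0 / 2"
    by (simp add: dist_norm norm_minus_commute)
  then have "\<bar>Re z - x0\<bar> < x0 / 2" "\<bar>Im z\<bar> < x0 / 2"
    using abs_Re_le_cmod[of "z - x0"] abs_Im_le_cmod[of "z - x0"] by auto
  then show "z \<in> {z. \<bar>Im z\<bar> < Re z}" by (auto simp: abs_if split: if_splits)
qed

lemma conga_line_taylor_sums:
  fixes \<alpha> t :: real and w :: "real \<Rightarrow> real"
  assumes "continuous_on {0..1} w" "0 < \<alpha>" "\<alpha> < 1" "0 < t"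
    and "0 < x0" and x: "x \<in> ball x0 (x0 / 2)"
  shows "(\<lambda>n. (deriv ^^ n) (conga_line \<alpha> t w) x0 / fact n * (x - x0) ^ n)
           sums conga_line \<alpha> t w x"
proof -
  obtain F where F: "F holomorphic_on {z. \<bar>Im z\<bar> < Re z}"
    "\<And>y. 0 < y \<Longrightarrow> conga_line \<alpha> t w y = Re (F (of_real y))"
    using conga_line_eq_Re_holomorphic[OF assms(1-4)] by metis
  show ?thesis
  proof (rule taylor_sums_Re_holomorphic[OF _ _ x])
    show "F holomorphic_on ball (of_real x0) (x0 / 2)"
      using F(1) ball_subset_sector[OF \<open>0 < x0\<close>] by (rule holomorphic_on_subset)
    show "conga_line \<alpha> t w y = Re (F (of_real y))" if "y \<in> ball x0 (x0 / 2)" for y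
      using that \<open>0 < x0\<close> by (intro F(2)) (auto simp: dist_real_def abs_if split: if_splits)
  qed
qed

theorem corollary3p2:
  fixes M :: "'a measure" and W :: "real \<Rightarrow> 'a \<Rightarrow> real" and \<alpha> t :: real
  assumes "standard_brownian_motion M W"
    and "0 < \<alpha>" and "\<alpha> < 1"
    and "0 < t"
  shows "AE \<omega> in M.
    real_analytic_on (conga_line \<alpha> t (\<lambda>s. W s \<omega>)) {0<..<1} \<and>
    (\<forall>x\<^sub>0\<in>{0<..<1}. \<forall>x\<in>{sqrt 2 * x\<^sub>0 / (1 + sqrt 2)<..<min (sqrt 2 * x\<^sub>0) 1}.
       (\<lambda>n. (deriv ^^ n) (conga_line \<alpha> t (\<lambda>s. W s \<omega>)) x\<^sub>0 / fact n * (x - x\<^sub>0) ^ n)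
         sums conga_line \<alpha> t (\<lambda>s. W s \<omega>) x)"
  using standard_brownian_motion.continuous_paths[OF assms(1)]
proof eventually_elim
  case (elim \<omega>)
  note taylor = conga_line_taylor_sums[OF elim assms(2-4)]
  have "real_analytic_on (conga_line \<alpha> t (\<lambda>s. W s \<omega>)) {0<..<1}"
    unfolding real_analytic_on_def
  proof
    fix x0 :: real
    assume "x0 \<in> {0<..<1}"
    then show "\<exists>a. \<exists>r>0. \<forall>x\<in>ball x0 r. (\<lambda>n. a n * (x - x0) ^ n) sums conga_line \<alpha> t (\<lambda>s. W s \<omega>) x"
      using taylor[of x0] by (intro exI[of _ "\<lambda>n. _ n / fact n"] exI[of _ "x0 / 2"]) auto
  qed
  moreover have "x \<in> ball x0 (x0 / 2)"
    if "0 < x0" "x \<in> {sqrt 2 * x0 / (1 + sqrt 2)<..<min (sqrt 2 * x0) 1}" for x0 x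
  proof -
    \<comment> \<open>The lower endpoint exceeds \<open>x0 / 2\<close> as \<open>1 < sqrt 2\<close>; the upper one is below \<open>3 / 2 * x0\<close>.\<close>
    have sqrt2: "1 < sqrt 2" "sqrt 2 < 3 / 2"
      by (simp, rule real_less_lsqrt) (auto simp: power2_eq_square)
    have "x0 / 2 * (1 + sqrt 2) \<le> sqrt 2 * x0"
      using mult_left_mono[of 1 "sqrt 2" "x0"] sqrt2 that(1) by (simp add: field_simps)
    then have "x0 / 2 \<le> sqrt 2 * x0 / (1 + sqrt 2)"
      using sqrt2 by (subst pos_le_divide_eq) linarith+
    moreover have "sqrt 2 * x0 \<le> 3 / 2 * x0"
      using sqrt2 that(1) by (intro mult_right_mono) auto
    ultimately have "x0 / 2 < x" "x < 3 / 2 * x0"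
      using that(2) unfolding greaterThanLessThan_iff min_less_iff_conj by linarith+
    then show ?thesis
      by (auto simp: dist_real_def abs_if)
  qed
  ultimately show ?case
    using taylor by auto
qed

end
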